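(* Let $n > 1$ and $b > 1$ be integers. Then $$PD(X_b^n) = \begin{cases} \dfrac{\binom{\frac{n}{2}+b-1}{b-1}}{\binom{n+b-1}{b-1}} & \text{if } n \text{ is even},\\[3ex] \dfrac{b\binom{\frac{n-1}{2}+b-1}{b-1}}{\binom{n+b-1}{b-1}} & \text{if } n \text{ is odd}.\end{cases}$$
   Context: For integers $b > 1$ and $n > 1$, let $X_b$ be a set of $b$ distinct elements, and let $X_b^n$ be the set of all multisets $X = \{x_1,\dots,x_n\}$ of cardinality $n$ (counted with multiplicity) whose elements lie in $X_b$. A multiset $X=\{x_1,\dots,x_n\} \in X_b^n$ is called palindromic if its elements can be arranged into a palindrome, i.e. there exist pairwise distinct indices $i_1,\dots,i_n \in \{1,\dots,n\}$ such that $(x_{i_1},\dots,x_{i_n}) = (x_{i_n},\dots,x_{i_1})$. Let $P_b^n \subset X_b^n$ be the set of palindromic multisets in $X_b^n$. The palindromic density of $X_b^n$ is $PD(X_b^n) := |P_b^n| / |X_b^n|$. *)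

theory Defs
  imports Complex_Main "HOL-Library.Multiset"
begin

(* A list xs with mset xs = X is exactly an arrangement of the elements of X,
   each one occurring as often as its multiplicity. *)
definition palindromic :: "'a multiset \<Rightarrow> bool" where
  "palindromic X \<longleftrightarrow> (\<exists>xs. mset xs = X \<and> xs = rev xs)"

definition palindromic_multisets :: "'a set \<Rightarrow> nat \<Rightarrow> 'a multiset set" where
  "palindromic_multisets A n = {X \<in> multisets_of_size A n. palindromic X}"

definition palindromic_density :: "'a set \<Rightarrow> nat \<Rightarrow> real" where
  "palindromic_density A n =
     real (card (palindromic_multisets A n)) / real (card (multisets_of_size A n))"

end

theory Submission
  imports Defs
begin

text \<open>
  A palindrome reads \<open>ys @ zs @ rev ys\<close> with a middle part \<open>zs\<close> of length at most one, so a
  multiset is palindromic exactly when it is twice some multiset \<open>Y\<close>, plus at most one further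
  element. The parity of the size decides whether that further element \<open>a\<close> is present.
  Multiplying by two is injective, and \<open>a\<close> can be recovered as the only element of odd
  multiplicity. Hence the palindromic multisets of size \<open>2 * k\<close> correspond to the multisets \<open>Y\<close>
  of size \<open>k\<close>, and those of size \<open>2 * k + 1\<close> to the pairs \<open>(a, Y)\<close>, which accounts for the
  factor \<open>b\<close> in the odd case. The density formula then follows by stars and bars.
\<close>

lemma palindrome_halves:
  assumes "xs = rev xs"
  obtains ys zs where "xs = ys @ zs @ rev ys" and "length zs = length xs mod 2"
proof
  define k where "k = length xs div 2"
  define ys where "ys = take k xs"
  define zs where "zs = drop k (take (length xs - k) xs)"
  have k: "k \<le> length xs - k"
    unfolding k_def by linarith
  have "rev ys = drop (length xs - k) xs"
    unfolding ys_def by (simp add: rev_take flip: assms)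
  moreover have "take (length xs - k) xs = ys @ zs"
    using append_take_drop_id [of k "take (length xs - k) xs"] k by (simp add: ys_def zs_def)
  ultimately show "xs = ys @ zs @ rev ys"
    using append_take_drop_id [of "length xs - k" xs] by simp
  show "length zs = length xs mod 2"
    unfolding zs_def k_def by simp presburger
qed

text \<open>
  The first half of a palindromic arrangement gives \<open>Y\<close> and its middle part gives \<open>Z\<close>.
  Conversely, placing \<open>Z\<close> between an arrangement of \<open>Y\<close> and the reversal of that arrangement
  gives a palindrome, because a list of length at most one equals its reversal.
\<close>

lemma palindromic_iff_double_plus:
  "palindromic X \<longleftrightarrow> (\<exists>Y Z. X = repeat_mset 2 Y + Z \<and> size Z = size X mod 2)"
proof
  assume "palindromic X"
  then obtain xs where xs: "mset xs = X" "xs = rev xs"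
    unfolding palindromic_def by blast
  obtain ys zs where eq: "xs = ys @ zs @ rev ys" and len: "length zs = length xs mod 2"
    using palindrome_halves[OF xs(2)] .
  have "X = repeat_mset 2 (mset ys) + mset zs"
    using xs(1) by (subst (asm) eq) (auto simp: numeral_2_eq_2 ac_simps)
  moreover have "size (mset zs) = size X mod 2"
    using xs(1) len by auto
  ultimately show "\<exists>Y Z. X = repeat_mset 2 Y + Z \<and> size Z = size X mod 2"
    by blast
next
  assume "\<exists>Y Z. X = repeat_mset 2 Y + Z \<and> size Z = size X mod 2"
  then obtain Y Z where X: "X = repeat_mset 2 Y + Z" and Z: "size Z = size X mod 2"
    by blast
  obtain ys zs where ys: "mset ys = Y" and zs: "mset zs = Z"
    using ex_mset by metis
  have "length zs \<le> 1"
    using Z by (simp flip: zs)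
  then have "rev zs = zs"
    by (cases zs) auto
  then have "ys @ zs @ rev ys = rev (ys @ zs @ rev ys)"
    by simp
  moreover have "mset (ys @ zs @ rev ys) = X"
    unfolding X ys [symmetric] zs [symmetric] by (simp add: numeral_2_eq_2)
  ultimately show "palindromic X"
    unfolding palindromic_def by (intro exI conjI)
qed

lemma set_mset_double: "set_mset (repeat_mset 2 Y) = set_mset Y"
  by (simp add: numeral_2_eq_2)

lemma palindromic_multisets_even:
  "palindromic_multisets A (2 * k) = repeat_mset 2 ` multisets_of_size A k"
proof (intro equalityI subsetI)
  fix X assume "X \<in> palindromic_multisets A (2 * k)"
  then have "palindromic X" and size: "size X = 2 * k" and sub: "set_mset X \<subseteq> A"
    by (simp_all add: palindromic_multisets_def multisets_of_size_def)
  then obtain Y Z where X: "X = repeat_mset 2 Y + Z" and Z: "size Z = size X mod 2"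
    unfolding palindromic_iff_double_plus by blast
  from Z size have "Z = {#}"
    by simp
  with X have "X = repeat_mset 2 Y"
    by simp
  moreover from this size sub have "Y \<in> multisets_of_size A k"
    by (simp add: multisets_of_size_def set_mset_double)
  ultimately show "X \<in> repeat_mset 2 ` multisets_of_size A k"
    by blast
next
  fix X assume "X \<in> repeat_mset 2 ` multisets_of_size A k"
  then obtain Y where X: "X = repeat_mset 2 Y" and "Y \<in> multisets_of_size A k"
    by blast
  moreover have "palindromic X"
    unfolding palindromic_iff_double_plus X by (intro exI[of _ Y] exI[of _ "{#}"]) simp
  ultimately show "X \<in> palindromic_multisets A (2 * k)"
    by (simp add: palindromic_multisets_def multisets_of_size_def set_mset_double)
qed

lemma palindromic_multisets_odd:
  "palindromic_multisets A (2 * k + 1) =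
    (\<lambda>(a, Y). add_mset a (repeat_mset 2 Y)) ` (A \<times> multisets_of_size A k)"
proof (intro equalityI subsetI)
  fix X assume "X \<in> palindromic_multisets A (2 * k + 1)"
  then have "palindromic X" and size: "size X = 2 * k + 1" and sub: "set_mset X \<subseteq> A"
    by (simp_all add: palindromic_multisets_def multisets_of_size_def)
  then obtain Y Z where X: "X = repeat_mset 2 Y + Z" and Z: "size Z = size X mod 2"
    unfolding palindromic_iff_double_plus by blast
  from Z size have "size Z = 1"
    by simp
  then obtain a where "Z = {#a#}"
    using size_1_singleton_mset by blast
  with X have "X = add_mset a (repeat_mset 2 Y)"
    by simp
  moreover from this size sub have "a \<in> A" and "Y \<in> multisets_of_size A k"
    by (simp_all add: multisets_of_size_def set_mset_double)
  ultimately show "X \<in> (\<lambda>(a, Y). add_mset a (repeat_mset 2 Y)) ` (A \<times> multisets_of_size A k)"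
    by auto
next
  fix X assume "X \<in> (\<lambda>(a, Y). add_mset a (repeat_mset 2 Y)) ` (A \<times> multisets_of_size A k)"
  then obtain a Y where X: "X = add_mset a (repeat_mset 2 Y)"
    and "a \<in> A" and "Y \<in> multisets_of_size A k"
    by auto
  moreover have "palindromic X"
    unfolding palindromic_iff_double_plus X by (intro exI[of _ Y] exI[of _ "{#a#}"]) simp
  ultimately show "X \<in> palindromic_multisets A (2 * k + 1)"
    by (simp add: palindromic_multisets_def multisets_of_size_def set_mset_double)
qed

text \<open>The element \<open>a\<close> is the one whose multiplicity in the sum is odd.\<close>

lemma inj_add_mset_double:
  "inj (\<lambda>(a, Y). add_mset a (repeat_mset 2 Y))"
proof (rule injI, clarify)
  fix a b :: 'a and Y Z
  assume eq: "add_mset a (repeat_mset 2 Y) = add_mset b (repeat_mset 2 Z)"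
  have "odd (count (add_mset b (repeat_mset 2 Z)) a)"
    by (simp flip: eq)
  then have "a = b"
    by (auto split: if_splits)
  with eq show "a = b \<and> Y = Z"
    by (simp add: repeat_mset_cancel1)
qed

lemma card_multisets_of_size_complement:
  assumes "finite A" and "card A > 0"
  shows "card (multisets_of_size A n) = (n + card A - 1) choose (card A - 1)"
  using card_multisets_of_size[OF assms(1), of n] assms(2)
    binomial_symmetric[of n "n + card A - 1"]
  by (simp add: add.commute)

lemma card_palindromic_multisets_even:
  "card (palindromic_multisets A (2 * k)) = card (multisets_of_size A k)"
  unfolding palindromic_multisets_even
  by (intro card_image inj_onI) (simp add: repeat_mset_cancel1)

lemma card_palindromic_multisets_odd:
  "card (palindromic_multisets A (2 * k + 1)) = card A * card (multisets_of_size A k)"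
  unfolding palindromic_multisets_odd
  by (simp only: card_image[OF inj_on_subset[OF inj_add_mset_double subset_UNIV]]
      card_cartesian_product)

theorem corollary4p3p1:
  fixes A :: "'a set" and b n :: nat
  assumes "n > 1" and "b > 1" and "finite A" and "card A = b"
  shows "palindromic_density A n =
    (if even n
     then real ((n div 2 + b - 1) choose (b - 1)) / real ((n + b - 1) choose (b - 1))
     else real b * real (((n - 1) div 2 + b - 1) choose (b - 1)) / real ((n + b - 1) choose (b - 1)))"
proof -
  have count: "card (multisets_of_size A m) = (m + b - 1) choose (b - 1)" for m
    using card_multisets_of_size_complement[of A m] assms by simp
  show ?thesis
  proof (cases "even n")
    case True
    then have "card (palindromic_multisets A n) = card (multisets_of_size A (n div 2))"
      using card_palindromic_multisets_even[of A "n div 2"] by simp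
    with True show ?thesis
      by (simp add: palindromic_density_def count)
  next
    case False
    then have "card (palindromic_multisets A n) = b * card (multisets_of_size A ((n - 1) div 2))"
      using card_palindromic_multisets_odd[of A "(n - 1) div 2"] assms(4) by simp
    with False show ?thesis
      by (simp add: palindromic_density_def count)
  qed
qed

end
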